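(* Let $(E,w)$ be a multi-weighted graph. Suppose there exists a vertex $u\in E^0$ with $k_u>1$ (that is, $u$ emits edges of at least two distinct weights) such that there is no path of positive length in $E$ from $u$ to $u$. Then the weighted graph monoid $\mathcal{M}(E,w)$ is non-confluent.
   Context: $\mathbb N=\{1,2,\dots\}$. A directed graph is $E=(E^0,E^1,s,r)$ with vertex set $E^0$, edge set $E^1$ and source/range maps $s,r:E^1\to E^0$. A vertex $v$ is a sink if $s^{-1}(v)=\varnothing$ and regular if $0<|s^{-1}(v)|<\infty$. A path of positive length from $u$ to $v$ is a sequence $e_1\cdots e_n$ ($n\ge 1$) of edges with $r(e_i)=s(e_{i+1})$, $s(e_1)=u$, $r(e_n)=v$. A weighted graph $(E,w)$ is a directed graph $E$ with a map $w:E^1\to\mathbb N$. Standing assumption: weighted graphs are nonempty, row-finite ($|s^{-1}(v)|<\infty$ for all $v$) and connected (the underlying undirected graph is connected). $(E,w)$ is vertex-weighted if for every regular $v$ all edges in $s^{-1}(v)$ have the same weight, and multi-weighted otherwise. For $v\in E^0$ let $w_1(v)<\dots<w_{k_v}(v)$ be the distinct weights of the edges in $s^{-1}(v)$ (so $k_v=0$ for a sink), and put $w_0(v)=0$. Let $\mathcal E=\{v,q_1^v,\dots,q_{k_v-1}^v : v\in E^0\}$ (formal distinct symbols), let $F_{\mathcal E}$ be the free commutative monoid on $\mathcal E$, written additively, and set $q_0^v=q_{k_v}^v=0$ in $F_{\mathcal E}$. For regular $u$ and $\alpha\in w(s^{-1}(u))$ put $\Sigma_\alpha(u)=\sum_{e\in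 s^{-1}(u),\,w(e)=\alpha} r(e)\in F_{\mathcal E}$. Define the reduction relation $\to$ on $F_{\mathcal E}$ by $$y+q_{i-1}^u+(w_i(u)-w_{i-1}(u))u\ \to\ y+q_i^u+\Sigma_{w_i(u)}(u)$$ for all $y\in F_{\mathcal E}$, regular $u$ and $1\le i\le k_u$. Let $\to^*$ be its reflexive-transitive closure and $\sim$ the congruence it generates. The weighted graph monoid is $\mathcal M(E,w)=F_{\mathcal E}/\!\sim$. It is called confluent if for all $a,b\in F_{\mathcal E}$: $a\sim b$ if and only if there is $c\in F_{\mathcal E}$ with $a\to^* c$ and $b\to^* c$; otherwise it is non-confluent. *)

theory Defs
  imports
    "HOL-Library.Multiset"
    "HOL-Algebra.Group"
    "Graph_Theory.Arc_Walk"
    "Graph_Theory.Digraph_Component"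
begin

text \<open>
  Directed graphs are the \<^typ>\<open>('v, 'e) pre_digraph\<close> records of the AFP entry Graph\_Theory, so
  \<open>tail\<close> is the source map and \<open>head\<close> the range map.  Vertex and edge sets may be infinite, and
  loops and parallel edges are allowed.  The free commutative monoid on a set \<open>S\<close> is the set of
  multisets supported in \<open>S\<close>.
\<close>

datatype 'v wg_gen = Vtx 'v | Q 'v nat

locale pre_weighted_graph = pre_digraph G
  for G :: "('v, 'e) pre_digraph" (structure) +
  fixes w :: "'e \<Rightarrow> nat"
begin

definition regular :: "'v \<Rightarrow> bool" where
  "regular v \<longleftrightarrow> v \<in> verts G \<and> finite (out_arcs G v) \<and> out_arcs G v \<noteq> {}"

definition vertex_weighted :: bool where
  "vertex_weighted \<longleftrightarrow>
     (\<forall>v. regular v \<longrightarrow> (\<forall>e \<in> out_arcs G v. \<forall>f \<in> out_arcs G v. w e = w f))"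

abbreviation multi_weighted :: bool where
  "multi_weighted \<equiv> \<not> vertex_weighted"

definition num_weights :: "'v \<Rightarrow> nat" where
  "num_weights v = card (w ` out_arcs G v)"

text \<open>
  \<open>weight_at v i\<close> is the \<open>i\<close>-th smallest weight of the edges emitted by \<open>v\<close>, counted from \<open>1\<close>, and
  \<open>weight_at v 0 = 0\<close>.  It is only meaningful for \<open>i \<le> num_weights v\<close>.
\<close>
definition weight_at :: "'v \<Rightarrow> nat \<Rightarrow> nat" where
  "weight_at v i = (0 # sorted_list_of_set (w ` out_arcs G v)) ! i"

definition generators :: "'v wg_gen set" where
  "generators = Vtx ` verts G \<union> {Q v i |v i. v \<in> verts G \<and> 1 \<le> i \<and> i < num_weights v}"

definition free_monoid :: "'v wg_gen multiset set" where
  "free_monoid = {a. set_mset a \<subseteq> generators}"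

definition q :: "'v \<Rightarrow> nat \<Rightarrow> 'v wg_gen multiset" where
  "q v i = (if i = 0 \<or> i = num_weights v then {#} else {#Q v i#})"

definition range_sum :: "nat \<Rightarrow> 'v \<Rightarrow> 'v wg_gen multiset" where
  "range_sum \<alpha> u = (\<Sum>e \<in> {e \<in> out_arcs G u. w e = \<alpha>}. {#Vtx (head G e)#})"

inductive red :: "'v wg_gen multiset \<Rightarrow> 'v wg_gen multiset \<Rightarrow> bool" where
  "\<lbrakk>y \<in> free_monoid; regular u; 1 \<le> i; i \<le> num_weights u\<rbrakk> \<Longrightarrow>
     red (y + q u (i - 1) + replicate_mset (weight_at u i - weight_at u (i - 1)) (Vtx u))
         (y + q u i + range_sum (weight_at u i) u)"

inductive monoid_cong :: "'v wg_gen multiset \<Rightarrow> 'v wg_gen multiset \<Rightarrow> bool" where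
  base: "red a b \<Longrightarrow> monoid_cong a b"
| refl: "a \<in> free_monoid \<Longrightarrow> monoid_cong a a"
| sym: "monoid_cong a b \<Longrightarrow> monoid_cong b a"
| trans: "\<lbrakk>monoid_cong a b; monoid_cong b c\<rbrakk> \<Longrightarrow> monoid_cong a c"
| add: "\<lbrakk>monoid_cong a b; monoid_cong c d\<rbrakk> \<Longrightarrow> monoid_cong (a + c) (b + d)"

definition graph_monoid :: "'v wg_gen multiset set monoid" where
  "graph_monoid =
     \<lparr>carrier = free_monoid // {(a, b). monoid_cong a b},
      monoid.mult = (\<lambda>A B. \<Union>a \<in> A. \<Union>b \<in> B. {c. monoid_cong (a + b) c}),
      one = {c. monoid_cong {#} c}\<rparr>"

text \<open>
  Confluence is a property of the presentation of \<^const>\<open>graph_monoid\<close> by generators and reductions,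
  not of its isomorphism class.
\<close>
definition graph_monoid_confluent :: bool where
  "graph_monoid_confluent \<longleftrightarrow>
     (\<forall>a \<in> free_monoid. \<forall>b \<in> free_monoid.
        monoid_cong a b \<longleftrightarrow> (\<exists>c \<in> free_monoid. red\<^sup>*\<^sup>* a c \<and> red\<^sup>*\<^sup>* b c))"

end

text \<open>The constant \<^const>\<open>connected\<close> includes that the graph is nonempty.\<close>
locale weighted_graph = pre_weighted_graph G w + wf_digraph G
  for G :: "('v, 'e) pre_digraph" (structure) and w :: "'e \<Rightarrow> nat" +
  assumes connected: "connected G"
    and row_finite: "v \<in> verts G \<Longrightarrow> finite (out_arcs G v)"
    and weight_pos: "e \<in> arcs G \<Longrightarrow> 0 < w e"
begin

lemma zero_in_free_monoid: "{#} \<in> free_monoid"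
  by (simp add: free_monoid_def)

lemma add_in_free_monoid_iff:
  "a + b \<in> free_monoid \<longleftrightarrow> a \<in> free_monoid \<and> b \<in> free_monoid"
  by (auto simp: free_monoid_def)

lemma q_in_free_monoid:
  assumes "v \<in> verts G" "i \<le> num_weights v"
  shows "q v i \<in> free_monoid"
  using assms by (auto simp: q_def free_monoid_def generators_def)

lemma range_sum_in_free_monoid: "range_sum \<alpha> u \<in> free_monoid"
proof -
  have "(\<Sum>e \<in> A. {#Vtx (head G e)#}) \<in> free_monoid" if "A \<subseteq> arcs G" for A
    using that
    by (induction A rule: infinite_finite_induct) (auto simp: free_monoid_def generators_def)
  then show ?thesis by (simp add: range_sum_def subset_eq)
qed

lemma red_in_free_monoid:
  assumes "red a b" shows "a \<in> free_monoid \<and> b \<in> free_monoid"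
  using assms
proof cases
  case (1 y u i)
  then have "u \<in> verts G" by (simp add: regular_def)
  then have "replicate_mset n (Vtx u) \<in> free_monoid" for n
    by (auto simp: free_monoid_def generators_def)
  then show ?thesis
    using 1 q_in_free_monoid[OF \<open>u \<in> verts G\<close>] range_sum_in_free_monoid
    by (simp add: add_in_free_monoid_iff)
qed

lemma monoid_cong_in_free_monoid:
  "monoid_cong a b \<Longrightarrow> a \<in> free_monoid \<and> b \<in> free_monoid"
  by (induction rule: monoid_cong.induct)
    (auto simp: red_in_free_monoid add_in_free_monoid_iff)

lemma equiv_monoid_cong: "equiv free_monoid {(a, b). monoid_cong a b}"
proof (rule equivI)
  show "{(a, b). monoid_cong a b} \<subseteq> free_monoid \<times> free_monoid"
    using monoid_cong_in_free_monoid by blast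
  show "refl_on free_monoid {(a, b). monoid_cong a b}"
    by (auto simp: refl_on_def monoid_cong.refl)
  show "Relation.sym {(a, b). monoid_cong a b}"
    by (auto intro!: symI monoid_cong.sym)
  show "Relation.trans {(a, b). monoid_cong a b}"
    by (auto intro!: transI elim: monoid_cong.trans)
qed

lemma class_mult:
  assumes "a \<in> free_monoid" "b \<in> free_monoid"
  shows "{c. monoid_cong a c} \<otimes>\<^bsub>graph_monoid\<^esub> {c. monoid_cong b c} = {c. monoid_cong (a + b) c}"
  using assms
  by (auto simp: graph_monoid_def
      intro: monoid_cong.refl monoid_cong.trans[OF monoid_cong.add])

lemma carrier_graph_monoid:
  "carrier graph_monoid = (\<lambda>a. {c. monoid_cong a c}) ` free_monoid"
  by (auto simp: graph_monoid_def quotient_def)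

lemma comm_monoid_graph_monoid: "comm_monoid graph_monoid"
proof -
  have one: "\<one>\<^bsub>graph_monoid\<^esub> = {c. monoid_cong {#} c}"
    by (simp add: graph_monoid_def)
  show ?thesis
    by (rule comm_monoidI)
      (auto simp: carrier_graph_monoid one class_mult add_in_free_monoid_iff
        zero_in_free_monoid add_ac)
qed

end

end

theory Submission
  imports Defs
begin

text \<open>
  Write \<open>w\<^sub>1 < w\<^sub>2\<close> for the two smallest weights at \<open>u\<close>.  The first two reductions at \<open>u\<close> compete for
  copies of \<open>u\<close>: one spends \<open>w\<^sub>1\<close> copies to create \<open>q\<^sub>1\<close>, the other spends \<open>w\<^sub>2 - w\<^sub>1\<close> copies to
  destroy \<open>q\<^sub>1\<close>.  For \<open>N = max w\<^sub>1 (w\<^sub>2 - w\<^sub>1) < w\<^sub>2\<close> the element \<open>q\<^sub>1 + N u\<close> has enough copies for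
  either reduction, but not for both.

  Since no closed path passes through \<open>u\<close>, copies of \<open>u\<close> that are spent never come back: no vertex
  that a reduction can produce, starting from \<open>u\<close>, leads back to \<open>u\<close>
  (\<open>red_never_restores\<close>).  Hence, after the first reduction, fewer than \<open>w\<^sub>2 - w\<^sub>1\<close> copies of \<open>u\<close>
  are left forever, so the two symbols \<open>q\<^sub>1\<close> then present can never be destroyed
  (\<open>reds_keep_Q\<close>).  After the second one, fewer than \<open>w\<^sub>1\<close> copies are left forever, so \<open>q\<^sub>1\<close>, which
  is then absent, can never be created (\<open>reds_create_no_Q\<close>).  The two results are congruent but
  have no common reduct, as its number of symbols \<open>q\<^sub>1\<close> would have to be both at least two and zero.
\<close>

lemma in_sum_singletonD: "x \<in># (\<Sum>e\<in>A. {#f e#}) \<Longrightarrow> x \<in> f ` A"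
  by (induction A rule: infinite_finite_induct) auto

context weighted_graph
begin

lemma weight_at_strict:
  assumes "v \<in> verts G" "1 \<le> i" "i \<le> num_weights v"
  shows "weight_at v (i - 1) < weight_at v i"
proof -
  let ?W = "w ` out_arcs G v"
  have fin: "finite ?W"
    using row_finite[OF assms(1)] by simp
  have "\<forall>x \<in> ?W. 0 < x"
    using weight_pos by auto
  with fin have "sorted_wrt (<) (0 # sorted_list_of_set ?W)"
    by simp
  moreover have "i < length (0 # sorted_list_of_set ?W)"
    using assms(3) by (simp add: num_weights_def)
  moreover have "i - 1 < i"
    using assms(2) by simp
  ultimately show ?thesis
    unfolding weight_at_def by (metis sorted_wrt_nth_less)
qed

text \<open>
  A symbol \<^term>\<open>Q v i\<close> takes part in a reduction only together with copies of \<^term>\<open>Vtx v\<close>, so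
  whether copies of \<open>u\<close> can be produced from \<open>x\<close> depends on the vertices in \<open>x\<close> alone.
\<close>
definition never_restores :: "'v \<Rightarrow> 'v wg_gen multiset \<Rightarrow> bool" where
  "never_restores u x \<longleftrightarrow> (\<forall>v p. Vtx v \<in># x \<longrightarrow> p \<noteq> [] \<longrightarrow> \<not> awalk v p u)"

lemma Vtx_in_range_sumD:
  assumes "Vtx v \<in># range_sum \<alpha> u"
  obtains e where "e \<in> out_arcs G u" "v = head G e"
  using in_sum_singletonD[OF assms[unfolded range_sum_def]] by auto

lemma Q_notin_range_sum: "count (range_sum \<alpha> u) (Q v j) = 0"
  by (auto simp: range_sum_def count_eq_zero_iff dest: in_sum_singletonD)

text \<open>
  A path to \<open>u\<close> from the range of an edge \<open>e\<close> extends by \<open>e\<close> to one from its source, so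
  \<^const>\<open>never_restores\<close> is inherited; and no such \<open>e\<close> ends in \<open>u\<close>, so the only change
  at the generators over \<open>u\<close> comes from the left side and the symbol \<open>q\<^sub>i\<close> of a reduction at \<open>u\<close>
  itself.
\<close>
lemma red_never_restores:
  assumes "red x y" "never_restores u x"
  shows "never_restores u y"
    and "(count y (Vtx u) = count x (Vtx u) \<and> (\<forall>j. count y (Q u j) = count x (Q u j)))
       \<or> (\<exists>i. 1 \<le> i \<and> i \<le> num_weights u
            \<and> count y (Vtx u) + (weight_at u i - weight_at u (i - 1)) = count x (Vtx u)
            \<and> (\<forall>j. count y (Q u j) + count (q u (i - 1)) (Q u j)
                  = count x (Q u j) + count (q u i) (Q u j)))"
      (is "?idle \<or> ?active")
proof -
  from assms(1) have "never_restores u y \<and> (?idle \<or> ?active)"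
  proof cases
    case (1 z v i)
    let ?d = "weight_at v i - weight_at v (i - 1)"
    have "0 < ?d"
      using weight_at_strict[of v i] 1 by (simp add: regular_def)
    then have "Vtx v \<in># x"
      using 1 by simp
    then have no_path: "\<not> awalk v p u" if "p \<noteq> []" for p
      using assms(2) that by (auto simp: never_restores_def)
    have no_path_from_head: "\<not> awalk (head G e) p u" if "e \<in> out_arcs G v" for e p
      using no_path[of "e # p"] that by (auto simp: awalk_Cons_iff)
    have Vtx_q: "Vtx a \<notin># q b j" for a b j
      by (simp add: q_def)
    have "never_restores u y"
      unfolding never_restores_def
    proof (intro allI impI)
      fix a and p :: "'e list"
      assume "Vtx a \<in># y" "p \<noteq> []"
      then consider "Vtx a \<in># z" | "Vtx a \<in># range_sum (weight_at v i) v"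
        using 1(2) Vtx_q by auto
      then show "\<not> awalk a p u"
      proof cases
        case 1
        then have "Vtx a \<in># x"
          using \<open>x = _\<close> by simp
        then show ?thesis
          using assms(2) \<open>p \<noteq> []\<close> by (auto simp: never_restores_def)
      next
        case 2
        then show ?thesis
          using Vtx_in_range_sumD no_path_from_head by metis
      qed
    qed
    moreover have "?idle \<or> ?active"
    proof -
      have "Vtx u \<notin># range_sum (weight_at v i) v"
      proof
        assume "Vtx u \<in># range_sum (weight_at v i) v"
        then obtain e where "e \<in> out_arcs G v" "u = head G e"
          using Vtx_in_range_sumD by metis
        then show False
          using no_path_from_head[of e "[]"] by (auto simp: awalk_Nil_iff)
      qed
      then have range_u: "count (range_sum (weight_at v i) v) (Vtx u) = 0"
        by (simp add: not_in_iff)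
      have q_u: "count (q v j) (Vtx u) = 0" for j
        by (simp add: q_def)
      show ?thesis
      proof (cases "v = u")
        case True
        then have ?active
          using 1 range_u q_u by (intro exI[of _ i]) (simp add: Q_notin_range_sum)
        then show ?thesis ..
      next
        case False
        then have "count (q v j) (Q u l) = 0" for j l
          by (simp add: q_def)
        then have ?idle
          using 1 range_u q_u False by (simp add: Q_notin_range_sum)
        then show ?thesis ..
      qed
    qed
    ultimately show ?thesis by blast
  qed
  then show "never_restores u y" and "?idle \<or> ?active"
    by blast+
qed

text \<open>
  Only the reduction at \<open>u\<close> with index \<open>j + 1\<close> destroys \<^term>\<open>Q u j\<close>, and it consumes more copies of \<open>u\<close>
  than \<open>x\<close> or, as reductions never increase their number, any reduct of \<open>x\<close> contains.
\<close>
lemma reds_keep_Q: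
  assumes "red\<^sup>*\<^sup>* x y" "never_restores u x"
    and "count x (Vtx u) < weight_at u (j + 1) - weight_at u j"
  shows "count x (Q u j) \<le> count y (Q u j)"
proof -
  from assms(1) have "never_restores u y \<and> count y (Vtx u) \<le> count x (Vtx u)
      \<and> count x (Q u j) \<le> count y (Q u j)"
  proof (induction rule: rtranclp_induct)
    case base
    then show ?case using assms(2) by simp
  next
    case (step y z)
    have "never_restores u z"
      using red_never_restores(1) step by blast
    moreover have "count z (Vtx u) \<le> count y (Vtx u) \<and> count y (Q u j) \<le> count z (Q u j)"
      using red_never_restores(2)[OF step(2) conjunct1[OF step.IH]]
    proof (elim disjE exE conjE)
      fix i
      assume i: "1 \<le> i"
        and vtx: "count z (Vtx u) + (weight_at u i - weight_at u (i - 1)) = count y (Vtx u)"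
        and Q: "\<forall>l. count z (Q u l) + count (q u (i - 1)) (Q u l)
                  = count y (Q u l) + count (q u i) (Q u l)"
      have "i \<noteq> j + 1"
        using vtx step.IH assms(3) by auto
      then have "count (q u (i - 1)) (Q u j) = 0"
        using i by (auto simp: q_def)
      then show ?thesis
        using vtx spec[OF Q, of j] by simp
    qed simp
    ultimately show ?case
      using step.IH by simp
  qed
  then show ?thesis by simp
qed

text \<open>
  Only the reduction at \<open>u\<close> with index \<open>j\<close> creates \<^term>\<open>Q u j\<close>, and it consumes more copies of \<open>u\<close>
  than \<open>x\<close> or, as reductions never increase their number, any reduct of \<open>x\<close> contains.
\<close>
lemma reds_create_no_Q:
  assumes "red\<^sup>*\<^sup>* x y" "never_restores u x"
    and "count x (Vtx u) < weight_at u j - weight_at u (j - 1)"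
  shows "count y (Q u j) \<le> count x (Q u j)"
proof -
  from assms(1) have "never_restores u y \<and> count y (Vtx u) \<le> count x (Vtx u)
      \<and> count y (Q u j) \<le> count x (Q u j)"
  proof (induction rule: rtranclp_induct)
    case base
    then show ?case using assms(2) by simp
  next
    case (step y z)
    have "never_restores u z"
      using red_never_restores(1) step by blast
    moreover have "count z (Vtx u) \<le> count y (Vtx u) \<and> count z (Q u j) \<le> count y (Q u j)"
      using red_never_restores(2)[OF step(2) conjunct1[OF step.IH]]
    proof (elim disjE exE conjE)
      fix i
      assume vtx: "count z (Vtx u) + (weight_at u i - weight_at u (i - 1)) = count y (Vtx u)"
        and Q: "\<forall>l. count z (Q u l) + count (q u (i - 1)) (Q u l)
                  = count y (Q u l) + count (q u i) (Q u l)"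
      have "i \<noteq> j"
        using vtx step.IH assms(3) by auto
      then have "count (q u i) (Q u j) = 0"
        by (auto simp: q_def)
      then show ?thesis
        using vtx spec[OF Q, of j] by simp
    qed simp
    ultimately show ?case
      using step.IH by simp
  qed
  then show ?thesis by simp
qed

lemma not_confluent_if_no_closed_walk:
  assumes u: "u \<in> verts G" and k: "num_weights u > 1"
    and no_closed: "\<And>p. p \<noteq> [] \<Longrightarrow> \<not> awalk u p u"
  shows "\<not> graph_monoid_confluent"
proof
  assume confluent: graph_monoid_confluent
  define w1 w2 where "w1 = weight_at u 1" and "w2 = weight_at u 2"
  have w0: "weight_at u 0 = 0"
    by (simp add: weight_at_def)
  have w1: "0 < w1" and w2: "w1 < w2"
    using weight_at_strict[OF u, of 1] weight_at_strict[OF u, of 2] k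
    by (simp_all add: w1_def w2_def w0)
  define N where "N = max w1 (w2 - w1)"
  define Q1 where "Q1 = {#Q u 1#}"
  have q0: "q u 0 = {#}" and q1: "q u 1 = Q1"
    using k by (simp_all add: q_def Q1_def)
  have "out_arcs G u \<noteq> {}"
    using k by (auto simp: num_weights_def)
  then have regular: "regular u"
    using u row_finite by (simp add: regular_def)
  define a where "a = Q1 + replicate_mset N (Vtx u)"
  define x where
    "x = (Q1 + replicate_mset (N - w1) (Vtx u)) + q u 1 + range_sum w1 u"
  define y where
    "y = replicate_mset (N - (w2 - w1)) (Vtx u) + q u 2 + range_sum w2 u"
  have Q1_free: "Q1 \<in> free_monoid"
    using q_in_free_monoid[OF u, of 1] k unfolding q1 by simp
  have u_free: "replicate_mset n (Vtx u) \<in> free_monoid" for n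
    using u by (auto simp: free_monoid_def generators_def)
  have split_N: "replicate_mset N (Vtx u)
      = replicate_mset (N - m) (Vtx u) + replicate_mset m (Vtx u)" if "m \<le> N" for m
    using that by (simp add: multiset_eq_iff)
  have "red a x"
    using red.intros[of "Q1 + replicate_mset (N - w1) (Vtx u)" u 1]
      Q1_free u_free regular k split_N[of w1]
    by (simp add: add_in_free_monoid_iff a_def x_def N_def w1_def w0 q0 add_ac)
  have "red a y"
    using red.intros[of "replicate_mset (N - (w2 - w1)) (Vtx u)" u 2]
      u_free regular k split_N[of "w2 - w1"]
    by (simp add: a_def y_def N_def w1_def w2_def q1[simplified] add_ac)
  have "monoid_cong x y"
    using \<open>red a x\<close> \<open>red a y\<close> monoid_cong.base monoid_cong.sym monoid_cong.trans by blast
  then obtain c where xc: "red\<^sup>*\<^sup>* x c" and yc: "red\<^sup>*\<^sup>* y c"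
    using confluent red_in_free_monoid \<open>red a x\<close> \<open>red a y\<close>
    unfolding graph_monoid_confluent_def by blast
  have a_good: "never_restores u a"
    using no_closed by (auto simp: never_restores_def a_def Q1_def split: if_splits)
  have x_good: "never_restores u x" and y_good: "never_restores u y"
    using red_never_restores(1) a_good \<open>red a x\<close> \<open>red a y\<close> by blast+
  have range_u: "count (range_sum \<alpha> u) (Vtx u) = 0" for \<alpha>
  proof (rule ccontr)
    assume "count (range_sum \<alpha> u) (Vtx u) \<noteq> 0"
    then obtain e where "e \<in> out_arcs G u" "u = head G e"
      using Vtx_in_range_sumD by (metis count_eq_zero_iff)
    then show False
      using no_closed[of "[e]"] u by (auto simp: awalk_Cons_iff awalk_Nil_iff)
  qed
  have "count x (Vtx u) = N - w1"
    by (simp add: x_def q1[simplified] Q1_def range_u)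
  then have "count x (Vtx u) < w2 - w1"
    using w1 w2 by (simp add: N_def)
  then have "count x (Q u 1) \<le> count c (Q u 1)"
    using reds_keep_Q[OF xc x_good, of 1] by (simp add: w1_def w2_def numeral_2_eq_2)
  moreover have "count x (Q u 1) = 2"
    by (simp add: x_def q1[simplified] Q1_def Q_notin_range_sum)
  moreover have "count y (Vtx u) = N - (w2 - w1)"
    by (simp add: y_def q_def range_u)
  then have "count y (Vtx u) < w1"
    using w1 w2 by (simp add: N_def)
  then have "count c (Q u 1) \<le> count y (Q u 1)"
    using reds_create_no_Q[OF yc y_good, of 1] by (simp add: w1_def w0)
  \<comment> \<open>\<open>q\<^sub>2\<close> is \<open>0\<close> if \<open>u\<close> has only two weights, and a symbol other than \<open>q\<^sub>1\<close> otherwise.\<close>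
  moreover have "count y (Q u 1) = 0"
    by (simp add: y_def q_def Q_notin_range_sum)
  ultimately show False by simp
qed

end

theorem lemma3p20:
  fixes G :: "('v, 'e) pre_digraph" and w :: "'e \<Rightarrow> nat"
  assumes "weighted_graph G w"
    and "pre_weighted_graph.multi_weighted G w"
    and "\<exists>u \<in> verts G. pre_weighted_graph.num_weights G w u > 1
           \<and> \<not> (\<exists>p. p \<noteq> [] \<and> pre_digraph.awalk G u p u)"
  shows "\<not> pre_weighted_graph.graph_monoid_confluent G w"
  using weighted_graph.not_confluent_if_no_closed_walk[OF assms(1)] assms(3) by blast

end
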